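(* Let $n$ be a positive integer, let $r$ be the number of distinct prime factors of $n$, and let $n_0$ be the product of these primes. If $\mathbb{Z}_n$ has a minimal generating set of size $k$, then $k\le r$. Moreover, if $r>2$, then for every positive integer $k$ the set $G_k$ of all minimal generating sets of $\mathbb{Z}_n$ of size $k$ is $$G_k=\Big\{\{g_1,\dots,g_k\}\ :\ g_i\in[d_{s_i}]\ (1\le i\le k)\ \text{with}\ \gcd(d_{s_1},\dots,d_{s_k})=1\ \text{but}\ \gcd(d_{i_1},\dots,d_{i_{k-1}})\neq 1\ \text{for every choice of } k-1 \text{ of the } k \text{ indices } s_1,\dots,s_k\Big\},$$ where $d_{s_1},\dots,d_{s_k}$ are positive divisors of $n_0$ and, for $k=1$, the gcd of the empty family is taken to be $0$.
   Context: $\mathbb{Z}_n=\{0,1,\dots,n-1\}$ is the additive group of integers modulo $n$. A generating set of a group is minimal if no proper subset of it generates the group; its size is its number of (distinct) elements. For a positive divisor $d$ of $n_0$, put $[d]=\{a\in\mathbb{Z}_n : \gcd(a,n_0)=d\}$, with the convention $\gcd(0,n_0)=n_0$. The divisors of $n_0$ are indexed by binary sequences $s$ of length $r$: with $p_1<\dots<p_r$ the primes dividing $n$, $d_s=\prod_i p_i^{s^{(i)}}$ where $s^{(i)}\in\{0,1\}$ is the $i$-th entry of $s$. *)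

theory Defs
  imports
    "HOL-Algebra.Elementary_Groups"
    "HOL-Algebra.Generated_Groups"
    "HOL-Computational_Algebra.Primes"
begin

definition generating_set :: "('a, 'b) monoid_scheme \<Rightarrow> 'a set \<Rightarrow> bool" where
  "generating_set G S \<longleftrightarrow> S \<subseteq> carrier G \<and> generate G S = carrier G"

definition minimal_generating_set :: "('a, 'b) monoid_scheme \<Rightarrow> 'a set \<Rightarrow> bool" where
  "minimal_generating_set G S \<longleftrightarrow>
     generating_set G S \<and> (\<forall>T. T \<subset> S \<longrightarrow> \<not> generating_set G T)"

definition num_primes :: "nat \<Rightarrow> nat" where
  "num_primes n = card (prime_factors n)"

definition rad :: "nat \<Rightarrow> nat" where
  "rad n = \<Prod>(prime_factors n)"

definition binary_seqs :: "nat \<Rightarrow> nat list set" where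
  "binary_seqs r = {s. length s = r \<and> set s \<subseteq> {0, 1}}"

(* Positions are counted from 0, so the i-th entry of the increasing list of primes
   dividing n is the prime usually written p_(i+1). *)
definition div_of_seq :: "nat \<Rightarrow> nat list \<Rightarrow> nat" where
  "div_of_seq n s = (\<Prod>i<num_primes n. (sorted_list_of_set (prime_factors n) ! i) ^ (s ! i))"

definition residues_of_gcd :: "nat \<Rightarrow> nat \<Rightarrow> int set" where
  "residues_of_gcd n d = {a \<in> carrier (integer_mod_group n). gcd a (int (rad n)) = int d}"

definition min_gen_sets_of_size :: "nat \<Rightarrow> nat \<Rightarrow> int set set" where
  "min_gen_sets_of_size n k = {S. minimal_generating_set (integer_mod_group n) S \<and> card S = k}"

end

theory Submission
  imports Defs
begin

text \<open>
  A set of residues generates $\mathbb{Z}_n$ iff no prime divisor of $n$ divides all of its elements.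
  Hence in a minimal generating set every element $x$ has a prime divisor of $n$ dividing all the
  other elements but not $x$, and distinct elements get distinct primes. The description of the
  minimal generating sets follows since the divisor $d_s$ attached to $a$ is $\gcd(a, n_0)$, which
  records exactly which primes dividing $n$ divide $a$.
\<close>

section \<open>Generating sets of Z_n and the primes dividing n\<close>

lemma carrier_integer_mod_group_pos:
  assumes "n > 0"
  shows "carrier (integer_mod_group n) = {0..<int n}"
  using assms by (auto simp: carrier_integer_mod_group)

text \<open>Since \<open>p\<close> divides \<open>n\<close>, reduction modulo \<open>n\<close> does
  not affect divisibility by \<open>p\<close>. For prime \<open>p\<close> this is the proper
  subgroup that traps sets that fail to generate.\<close>

lemma subgroup_multiples_integer_mod_group:
  assumes n: "n > 0" and p: "p dvd int n"
  shows "subgroup {x \<in> carrier (integer_mod_group n). p dvd x} (integer_mod_group n)"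
proof -
  interpret group "integer_mod_group n" by simp
  show ?thesis
  proof (rule subgroupI)
    show "{x \<in> carrier (integer_mod_group n). p dvd x} \<noteq> {}"
      using n by (auto simp: carrier_integer_mod_group_pos intro!: exI[of _ 0])
  next
    fix a assume "a \<in> {x \<in> carrier (integer_mod_group n). p dvd x}"
    then show "inv\<^bsub>integer_mod_group n\<^esub> a \<in> {x \<in> carrier (integer_mod_group n). p dvd x}"
      using p n inv_closed[of a] by (auto simp: inv_integer_mod_group dvd_mod_iff)
  next
    fix a b
    assume "a \<in> {x \<in> carrier (integer_mod_group n). p dvd x}"
      and "b \<in> {x \<in> carrier (integer_mod_group n). p dvd x}"
    then show "a \<otimes>\<^bsub>integer_mod_group n\<^esub> b \<in> {x \<in> carrier (integer_mod_group n). p dvd x}"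
      using p n m_closed[of a b] by (auto simp: mult_integer_mod_group dvd_mod_iff)
  qed auto
qed

text \<open>Bezout, one element at a time. The set \<open>F\<close> consists of integers rather than
  residues, so that \<open>n\<close> itself, which reduces to the identity, may be a member.\<close>

lemma Gcd_mod_in_subgroup:
  assumes n: "n > 0" and H: "subgroup H (integer_mod_group n)"
    and "finite F" and "\<forall>x\<in>F. x mod int n \<in> H"
  shows "Gcd F mod int n \<in> H"
  using assms(3,4)
proof (induction F rule: finite_induct)
  case empty
  then show ?case using subgroup.one_closed[OF H] by simp
next
  case (insert x F)
  interpret group "integer_mod_group n" by simp
  have scale: "(k * y) mod int n \<in> H" if "y mod int n \<in> H" for k y
    using subgroup_int_pow_closed[OF H that, of k]
    by (simp add: int_pow_integer_mod_group mod_mult_right_eq)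
  obtain u v where uv: "u * x + v * Gcd F = gcd x (Gcd F)"
    using bezout_int by blast
  have "((u * x) mod int n) \<otimes>\<^bsub>integer_mod_group n\<^esub> ((v * Gcd F) mod int n) \<in> H"
    using insert by (intro subgroup.m_closed[OF H] scale) auto
  then show ?case
    by (simp add: mult_integer_mod_group mod_add_eq uv)
qed

text \<open>A prime factor of \<open>n\<close> dividing all of \<open>S\<close> confines the
  generated subgroup to its multiples, which miss 1. Without such a prime, \<open>S\<close> together
  with \<open>n\<close> has gcd 1, and Bezout puts 1 into the generated subgroup.\<close>

lemma generating_set_integer_mod_group_iff:
  assumes n: "n > 0" and S: "S \<subseteq> carrier (integer_mod_group n)"
  shows "generating_set (integer_mod_group n) S \<longleftrightarrow>
    (\<forall>p\<in>prime_factors n. \<exists>x\<in>S. \<not> int p dvd x)"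
proof -
  let ?G = "integer_mod_group n"
  interpret group ?G by simp
  show ?thesis
  proof
    assume gen: "generating_set ?G S"
    show "\<forall>p\<in>prime_factors n. \<exists>x\<in>S. \<not> int p dvd x"
    proof (intro ballI, rule ccontr)
      fix p assume p: "p \<in> prime_factors n" and "\<not> (\<exists>x\<in>S. \<not> int p dvd x)"
      then have "S \<subseteq> {x \<in> carrier ?G. int p dvd x}"
        using S by auto
      moreover have "subgroup {x \<in> carrier ?G. int p dvd x} ?G"
        using n p by (intro subgroup_multiples_integer_mod_group) auto
      ultimately have "carrier ?G \<subseteq> {x \<in> carrier ?G. int p dvd x}"
        using generate_subgroup_incl gen by (metis generating_set_def)
      moreover have "n > 1"
        using p n prime_factorization_1 by (cases "n = 1") auto
      then have "1 \<in> carrier ?G"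
        by (simp add: carrier_integer_mod_group_pos)
      ultimately have "int p dvd 1" by blast
      then show False using p by (auto simp: in_prime_factors_iff)
    qed
  next
    assume P: "\<forall>p\<in>prime_factors n. \<exists>x\<in>S. \<not> int p dvd x"
    have fin: "finite S"
      using S n by (auto simp: carrier_integer_mod_group_pos intro: finite_subset)
    have H: "subgroup (generate ?G S) ?G"
      using S by (rule generate_is_subgroup)
    \<comment> \<open>Adjoining \<open>n\<close> forces any common prime divisor to be a prime
      factor of \<open>n\<close>, and makes the claim meaningful for empty \<open>S\<close>
      too.\<close>
    have "Gcd (insert (int n) S) = 1"
    proof (rule ccontr)
      assume "Gcd (insert (int n) S) \<noteq> 1"
      moreover obtain m where m: "Gcd (insert (int n) S) = int m"
        using Gcd_int_greater_eq_0 nonneg_int_cases by blast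
      ultimately obtain p where p: "prime p" "p dvd m"
        using prime_factor_nat[of m] by auto
      then have "int p dvd Gcd (insert (int n) S)"
        unfolding m by simp
      then have dvd: "int p dvd x" if "x \<in> insert (int n) S" for x
        using that by (meson Gcd_dvd dvd_trans)
      from dvd[of "int n"] p n have "p \<in> prime_factors n"
        by (simp add: in_prime_factors_iff)
      then show False
        using P dvd by blast
    qed
    moreover have "Gcd (insert (int n) S) mod int n \<in> generate ?G S"
    proof (rule Gcd_mod_in_subgroup[OF n H])
      show "\<forall>x\<in>insert (int n) S. x mod int n \<in> generate ?G S"
        using S n subgroup.one_closed[OF H]
        by (auto simp: carrier_integer_mod_group_pos subset_eq intro: generate.incl)
    qed (use fin in simp)
    \<comment> \<open>The reduction is kept because for \<open>n = 1\<close> the integer 1 is not in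
      the carrier.\<close>
    ultimately have one: "1 mod int n \<in> generate ?G S" by simp
    have "x \<in> generate ?G S" if "x \<in> carrier ?G" for x
      using subgroup_int_pow_closed[OF H one, of x] that n
      by (simp add: int_pow_integer_mod_group mod_mult_right_eq carrier_integer_mod_group_pos)
    then show "generating_set ?G S"
      using S generate_incl by (auto simp: generating_set_def)
  qed
qed

section \<open>Monotonicity and the bound on the size of minimal generating sets\<close>

lemma generating_set_integer_mod_group_mono:
  assumes "n > 0" "generating_set (integer_mod_group n) S" "S \<subseteq> T"
    "T \<subseteq> carrier (integer_mod_group n)"
  shows "generating_set (integer_mod_group n) T"
proof -
  have "S \<subseteq> carrier (integer_mod_group n)" using assms by blast
  then have "\<forall>p\<in>prime_factors n. \<exists>x\<in>S. \<not> int p dvd x"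
    using assms(1,2) generating_set_integer_mod_group_iff by blast
  then show ?thesis
    using assms(3) generating_set_integer_mod_group_iff[OF assms(1,4)] by blast
qed

lemma card_minimal_generating_set_le:
  assumes n: "n > 0" and S: "minimal_generating_set (integer_mod_group n) S"
  shows "card S \<le> num_primes n"
proof -
  let ?G = "integer_mod_group n"
  have gen: "generating_set ?G S" and sub: "S \<subseteq> carrier ?G"
    using S by (auto simp: minimal_generating_set_def generating_set_def)
  have "\<exists>p\<in>prime_factors n. \<forall>y\<in>S - {x}. int p dvd y" if "x \<in> S" for x
  proof -
    have "\<not> generating_set ?G (S - {x})" and "S - {x} \<subseteq> carrier ?G"
      using S that sub by (auto simp: minimal_generating_set_def)
    then show ?thesis
      by (simp add: generating_set_integer_mod_group_iff[OF n])
  qed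
  then obtain f where f: "\<And>x. x \<in> S \<Longrightarrow> f x \<in> prime_factors n"
    "\<And>x y. x \<in> S \<Longrightarrow> y \<in> S - {x} \<Longrightarrow> int (f x) dvd y"
    using bchoice[of S "\<lambda>x p. p \<in> prime_factors n \<and> (\<forall>y\<in>S - {x}. int p dvd y)"] by blast
  \<comment> \<open>If \<open>f x = f y\<close> with \<open>x \<noteq> y\<close>, this prime divides
    all elements except \<open>x\<close>, and also all except \<open>y\<close>, hence all of
    \<open>S\<close>.\<close>
  have "inj_on f S"
  proof (rule inj_onI, rule ccontr)
    fix x y assume xy: "x \<in> S" "y \<in> S" "f x = f y" "x \<noteq> y"
    then have "\<forall>z\<in>S. int (f x) dvd z"
      using f(2)[of x] f(2)[of y] by auto
    then show False
      using gen f(1)[OF xy(1)] generating_set_integer_mod_group_iff[OF n sub] by blast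
  qed
  then show ?thesis
    unfolding num_primes_def using f(1) by (intro card_inj_on_le) auto
qed

section \<open>Divisors of the radical and their residue classes\<close>

lemma gcd_prod_distinct_primes:
  fixes a :: nat
  assumes "finite P" and "\<And>p. p \<in> P \<Longrightarrow> prime p"
  shows "gcd a (\<Prod>P) = (\<Prod>p\<in>P. if p dvd a then p else 1)"
  using assms
proof (induction P rule: finite_induct)
  case empty
  then show ?case by simp
next
  case (insert q F)
  \<comment> \<open>Distinct primes are coprime, so the contribution of \<open>q\<close> splits off
    from the gcd.\<close>
  have coprime: "coprime q (\<Prod>F)"
    using insert by (intro prod_coprime_right) (auto intro!: primes_coprime)
  have "gcd a (q * \<Prod>F) = (if q dvd a then q else 1) * gcd a (\<Prod>F)"
  proof (cases "q dvd a")
    case True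
    then obtain b where "a = q * b" ..
    then show ?thesis
      using coprime by (simp add: gcd_mult_left gcd_mult_left_left_cancel coprime_commute)
  next
    case False
    then have "coprime a q"
      using insert.prems prime_imp_coprime coprime_commute by blast
    then show ?thesis
      using False by (simp add: gcd_mult_right_left_cancel)
  qed
  then show ?case
    using insert by simp
qed

text \<open>The bit at the position of a prime records whether it divides \<open>a\<close>. This
  puts every element of Z_n into some class [d_s]; for \<open>a = 0\<close> all bits are 1, giving
  the convention gcd(0, n_0) = n_0.\<close>

lemma ex_binary_seq_gcd_rad:
  obtains s where "s \<in> binary_seqs (num_primes n)" "div_of_seq n s = gcd a (rad n)"
proof
  define ps where "ps = sorted_list_of_set (prime_factors n)"
  define s where "s = map (\<lambda>p. if p dvd a then 1 else 0 :: nat) ps"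
  have ps: "set ps = prime_factors n" "distinct ps" "length ps = num_primes n"
    by (auto simp: ps_def num_primes_def)
  show "s \<in> binary_seqs (num_primes n)"
    using ps by (auto simp: s_def binary_seqs_def)
  have "div_of_seq n s = (\<Prod>i<length ps. if ps ! i dvd a then ps ! i else 1)"
    by (auto simp: div_of_seq_def s_def ps(3) simp flip: ps_def intro!: prod.cong)
  also have "\<dots> = (\<Prod>p\<in>set ps. if p dvd a then p else 1)"
    using ps(2) by (intro prod.reindex_bij_betw bij_betw_nth) auto
  also have "\<dots> = gcd a (rad n)"
    unfolding ps(1) rad_def by (rule gcd_prod_distinct_primes[symmetric]) auto
  finally show "div_of_seq n s = gcd a (rad n)" .
qed

lemma prime_dvd_rad_iff:
  assumes "prime p"
  shows "p dvd rad n \<longleftrightarrow> p \<in> prime_factors n"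
  using assms primes_dvd_imp_eq
  by (auto simp: rad_def prime_dvd_prod_iff intro!: bexI[of _ p] dest: dvd_trans)

text \<open>For empty \<open>I\<close> the left-hand side is \<open>0 = 1\<close>, and the right-hand side fails because
  \<open>n > 1\<close>.\<close>

lemma GCD_eq_1_iff_generating_set:
  assumes n: "n > 1" and I: "\<And>i. i \<in> I \<Longrightarrow> g i \<in> residues_of_gcd n (d i)"
  shows "(GCD i\<in>I. d i) = 1 \<longleftrightarrow> generating_set (integer_mod_group n) (g ` I)"
proof -
  have d: "p dvd d i \<longleftrightarrow> int p dvd g i" if "i \<in> I" "p \<in> prime_factors n" for p i
  proof -
    have "int (d i) = gcd (g i) (int (rad n))"
      using I[OF that(1)] by (simp add: residues_of_gcd_def)
    then have "p dvd d i \<longleftrightarrow> int p dvd gcd (g i) (int (rad n))"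
      by (metis int_dvd_int_iff)
    then show ?thesis
      using that(2) by (auto simp: prime_dvd_rad_iff in_prime_factors_imp_prime)
  qed
  \<comment> \<open>This limits the primes dividing \<open>d i\<close> to those dividing
    \<open>n\<close>, the only ones that the generation criterion sees.\<close>
  have rad: "d i dvd rad n" if "i \<in> I" for i
    using I[OF that] unfolding residues_of_gcd_def
    by (metis (mono_tags, lifting) gcd_dvd2 int_dvd_int_iff mem_Collect_eq)
  \<comment> \<open>Applied to \<open>q\<close>, the criterion yields an element of
    \<open>I\<close>, so the empty family is excluded in the backward direction.\<close>
  obtain q where q: "q \<in> prime_factors n"
    using n by (metis in_prime_factors_iff less_irrefl not_one_less_zero prime_factor_nat)
  have "(GCD i\<in>I. d i) = 1 \<longleftrightarrow> (\<forall>p\<in>prime_factors n. \<exists>i\<in>I. \<not> int p dvd g i)"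
  proof
    assume eq: "(GCD i\<in>I. d i) = 1"
    show "\<forall>p\<in>prime_factors n. \<exists>i\<in>I. \<not> int p dvd g i"
    proof (intro ballI, rule ccontr)
      fix p assume p: "p \<in> prime_factors n" "\<not> (\<exists>i\<in>I. \<not> int p dvd g i)"
      then have "p dvd (GCD i\<in>I. d i)"
        using d by (intro Gcd_greatest) auto
      then show False
        using eq p(1) by (auto simp: in_prime_factors_iff)
    qed
  next
    assume P: "\<forall>p\<in>prime_factors n. \<exists>i\<in>I. \<not> int p dvd g i"
    show "(GCD i\<in>I. d i) = 1"
    proof (rule ccontr)
      assume "(GCD i\<in>I. d i) \<noteq> 1"
      then obtain p where p: "prime p" "p dvd (GCD i\<in>I. d i)"
        using prime_factor_nat by blast
      then have pd: "p dvd d i" if "i \<in> I" for i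
        using that by (meson Gcd_dvd dvd_trans imageI)
      obtain i where "i \<in> I" using P q by blast
      then have "p \<in> prime_factors n"
        using pd rad p(1) prime_dvd_rad_iff dvd_trans by blast
      then show False
        using P d pd by blast
    qed
  qed
  moreover have "g ` I \<subseteq> carrier (integer_mod_group n)"
    using I by (auto simp: residues_of_gcd_def)
  ultimately show ?thesis
    using generating_set_integer_mod_group_iff[of n "g ` I"] n by auto
qed

section \<open>Minimality in terms of indexed families\<close>

lemma minimal_generating_set_image_iff:
  assumes n: "n > 0" and k: "k > 0" and g: "g ` {1..k} \<subseteq> carrier (integer_mod_group n)"
  shows "minimal_generating_set (integer_mod_group n) (g ` {1..k}) \<and> card (g ` {1..k}) = k \<longleftrightarrow>
    generating_set (integer_mod_group n) (g ` {1..k}) \<and>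
    (\<forall>I. I \<subseteq> {1..k} \<and> card I = k - 1 \<longrightarrow> \<not> generating_set (integer_mod_group n) (g ` I))"
    (is "?L \<longleftrightarrow> ?R")
proof
  assume L: ?L
  then have inj: "inj_on g {1..k}"
    by (intro eq_card_imp_inj_on) auto
  show ?R
  proof (intro conjI allI impI)
    fix I assume I: "I \<subseteq> {1..k} \<and> card I = k - 1"
    \<comment> \<open>Here \<open>k > 0\<close> matters: the truncated difference
      \<open>k - 1\<close> is then strictly below \<open>k\<close>.\<close>
    then have "I \<subset> {1..k}"
      using k by auto
    then have "g ` I \<subset> g ` {1..k}"
      using inj by (metis image_strict_mono)
    then show "\<not> generating_set (integer_mod_group n) (g ` I)"
      using L by (auto simp: minimal_generating_set_def)
  qed (use L in \<open>simp add: minimal_generating_set_def\<close>)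
next
  assume R: ?R
  have rest: "\<not> generating_set (integer_mod_group n) (g ` ({1..k} - {j}))" if "j \<in> {1..k}" for j
    using R that by auto
  \<comment> \<open>A repeated value could be dropped without changing the image, leaving
    \<open>k - 1\<close> indices that still generate. Distinctness of the generators thus follows
    from the gcd conditions.\<close>
  have "inj_on g {1..k}"
  proof (rule inj_onI, rule ccontr)
    fix i j assume ij: "i \<in> {1..k}" "j \<in> {1..k}" "g i = g j" "i \<noteq> j"
    then have "g ` ({1..k} - {j}) = g ` {1..k}"
      by (auto simp: image_iff) (metis Diff_iff atLeastAtMost_iff singletonD)
    then show False
      using rest[OF ij(2)] R by simp
  qed
  \<comment> \<open>By monotonicity it suffices to delete a single index \<open>j\<close> whose
    value lies outside \<open>T\<close>.\<close>
  moreover have "\<not> generating_set (integer_mod_group n) T" if T: "T \<subset> g ` {1..k}" for T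
  proof
    assume gen: "generating_set (integer_mod_group n) T"
    obtain j where j: "j \<in> {1..k}" "g j \<notin> T"
      using T by blast
    then have "T \<subseteq> g ` ({1..k} - {j})"
      using T by blast
    then have "generating_set (integer_mod_group n) (g ` ({1..k} - {j}))"
      using g by (intro generating_set_integer_mod_group_mono[OF n gen]) auto
    then show False
      using rest[OF j(1)] by simp
  qed
  ultimately show ?L
    using R by (auto simp: minimal_generating_set_def card_image)
qed

theorem theorem2p0p6:
  fixes n :: nat
  assumes "n > 0"
  shows "(\<forall>k S. minimal_generating_set (integer_mod_group n) S \<and> card S = k
            \<longrightarrow> k \<le> num_primes n)
       \<and> (num_primes n > 2 \<longrightarrow>
           (\<forall>k>0. min_gen_sets_of_size n k =
              {g ` {1..k} | (g :: nat \<Rightarrow> int) (s :: nat \<Rightarrow> nat list).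
                 (\<forall>i\<in>{1..k}. s i \<in> binary_seqs (num_primes n)
                             \<and> g i \<in> residues_of_gcd n (div_of_seq n (s i)))
               \<and> (GCD i\<in>{1..k}. div_of_seq n (s i)) = 1
               \<and> (\<forall>I. I \<subseteq> {1..k} \<and> card I = k - 1
                      \<longrightarrow> (GCD i\<in>I. div_of_seq n (s i)) \<noteq> 1)}))"
proof (intro conjI allI impI)
  show "k \<le> num_primes n"
    if "minimal_generating_set (integer_mod_group n) S \<and> card S = k" for k S
    using card_minimal_generating_set_le[OF assms] that by blast
next
  fix k :: nat
  assume r: "num_primes n > 2" and k: "k > 0"
  let ?G = "integer_mod_group n"
  \<comment> \<open>With \<open>n > 1\<close> the empty family, which occurs among the subfamilies
    when \<open>k = 1\<close>, has gcd 0 and indeed does not generate.\<close>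
  have n: "n > 1"
    using r assms by (cases "n = 1") (auto simp: num_primes_def)
  \<comment> \<open>Both inclusions rest on this equivalence; what remains is to enumerate a given
    set and choose a sequence for each element.\<close>
  have iff: "(GCD i\<in>{1..k}. div_of_seq n (s i)) = 1
      \<and> (\<forall>I. I \<subseteq> {1..k} \<and> card I = k - 1 \<longrightarrow> (GCD i\<in>I. div_of_seq n (s i)) \<noteq> 1)
    \<longleftrightarrow> g ` {1..k} \<in> min_gen_sets_of_size n k"
    if g: "\<forall>i\<in>{1..k}. g i \<in> residues_of_gcd n (div_of_seq n (s i))" for g s
  proof -
    have gcd: "(GCD i\<in>I. div_of_seq n (s i)) = 1 \<longleftrightarrow> generating_set ?G (g ` I)"
      if "I \<subseteq> {1..k}" for I
      using g that by (intro GCD_eq_1_iff_generating_set[OF n]) auto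
    have "g ` {1..k} \<subseteq> carrier ?G"
      using g by (auto simp: residues_of_gcd_def)
    then show ?thesis
      using minimal_generating_set_image_iff[OF assms k] gcd
      by (auto simp: min_gen_sets_of_size_def)
  qed
  show "min_gen_sets_of_size n k =
              {g ` {1..k} | (g :: nat \<Rightarrow> int) (s :: nat \<Rightarrow> nat list).
                 (\<forall>i\<in>{1..k}. s i \<in> binary_seqs (num_primes n)
                             \<and> g i \<in> residues_of_gcd n (div_of_seq n (s i)))
               \<and> (GCD i\<in>{1..k}. div_of_seq n (s i)) = 1
               \<and> (\<forall>I. I \<subseteq> {1..k} \<and> card I = k - 1
                      \<longrightarrow> (GCD i\<in>I. div_of_seq n (s i)) \<noteq> 1)}" (is "_ = ?R")
  proof (intro equalityI subsetI)
    fix S assume S: "S \<in> min_gen_sets_of_size n k"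
    then have sub: "S \<subseteq> carrier ?G" and card: "card S = k"
      by (auto simp: min_gen_sets_of_size_def minimal_generating_set_def generating_set_def)
    have "finite S"
      using card k card_ge_0_finite by blast
    then obtain g where "bij_betw g {1..k} S"
      using card ex_bij_betw_nat_finite_1 by blast
    then have img: "g ` {1..k} = S"
      by (simp add: bij_betw_def)
    have "\<exists>t. t \<in> binary_seqs (num_primes n) \<and> g i \<in> residues_of_gcd n (div_of_seq n t)"
      if "i \<in> {1..k}" for i
    proof -
      have gi: "g i \<in> carrier ?G"
        using that img sub by blast
      then obtain a where a: "g i = int a"
        using assms by (auto simp: carrier_integer_mod_group_pos elim: nonneg_int_cases)
      show ?thesis
        using ex_binary_seq_gcd_rad[of n a] gi
        unfolding residues_of_gcd_def a by (metis (mono_tags, lifting) gcd_int_int_eq mem_Collect_eq)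
    qed
    then obtain s where s: "\<forall>i\<in>{1..k}. s i \<in> binary_seqs (num_primes n) \<and>
        g i \<in> residues_of_gcd n (div_of_seq n (s i))"
      by metis
    then show "S \<in> ?R"
      using iff[of g s] S img by blast
  next
    fix S assume "S \<in> ?R"
    then show "S \<in> min_gen_sets_of_size n k"
      using iff by blast
  qed
qed

end
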